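(* Consider the time-dependent balls and bins model with feedback exponent $\alpha>1$. Suppose that the limit $\theta=\lim_{n\to\infty}\alpha^{-n}\log\tau_n$ exists and $\theta\in(0,\infty)$. Let $$\mathcal{M}=\{B_n=0\text{ for all sufficiently large }n\}\cup\{B_n=\sigma_n\text{ for all sufficiently large }n\}.$$ If $\sum_{n=0}^{\infty}\frac{\tau_{n+1}}{\tau_n^{\alpha}}=\infty$ then $\mathbb{P}(\mathcal{M})=0$. If $\sum_{n=0}^{\infty}\frac{\tau_{n+1}}{\tau_n^{\alpha}}<\infty$ then $0<\mathbb{P}(\mathcal{M})<1$.
   Context: The time-dependent balls and bins model with two bins: let $(\sigma_n)_{n\ge 1}$ be a sequence of positive integers, let $\tau_0$ and $T_0$ be integers with $0<T_0<\tau_0$, and let $\tau_n=\tau_0+\sum_{i=1}^n\sigma_i$. With feedback exponent $\alpha$, define for $n\ge 0$: $\Theta_n=T_n/\tau_n$, $P_n=\frac{\Theta_n^{\alpha}}{\Theta_n^{\alpha}+(1-\Theta_n)^{\alpha}}$, and $T_{n+1}=T_n+B_{n+1}$, where conditionally on $\mathcal{F}_n=\sigma(B_1,\dots,B_n)$ the random variable $B_{n+1}$ is Binomial with size $\sigma_{n+1}$ (number of trials) and success probability $P_n$. Thus $T_n$ is the number of balls in the first bin at time $n$ out of $\tau_n$ balls in total. The event $\mathcal{M}$ is called monopoly. *)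

theory Defs
  imports "HOL-Probability.Probability"
begin

text \<open>
  The number of trials at time \<open>n \<ge> 1\<close> is \<open>\<sigma> n\<close>, and \<open>B n\<close> is the number of those balls
  that land in the first bin; the values \<open>\<sigma> 0\<close> and \<open>B 0\<close> play no role.
\<close>

definition total_balls :: "nat \<Rightarrow> (nat \<Rightarrow> nat) \<Rightarrow> nat \<Rightarrow> nat" where
  "total_balls \<tau>\<^sub>0 \<sigma> n = \<tau>\<^sub>0 + (\<Sum>i=1..n. \<sigma> i)"

definition first_bin :: "nat \<Rightarrow> (nat \<Rightarrow> 'a \<Rightarrow> nat) \<Rightarrow> nat \<Rightarrow> 'a \<Rightarrow> nat" where
  "first_bin T\<^sub>0 B n \<omega> = T\<^sub>0 + (\<Sum>i=1..n. B i \<omega>)"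

definition feedback :: "real \<Rightarrow> real \<Rightarrow> real" where
  "feedback \<alpha> x = x powr \<alpha> / (x powr \<alpha> + (1 - x) powr \<alpha>)"

definition natural_filtration :: "'a measure \<Rightarrow> (nat \<Rightarrow> 'a \<Rightarrow> nat) \<Rightarrow> nat \<Rightarrow> 'a measure" where
  "natural_filtration M B n =
     sigma (space M) (\<Union>i\<in>{1..n}. sets (vimage_algebra (space M) (B i) (count_space UNIV)))"

locale balls_and_bins = prob_space M
  for M :: "'a measure" +
  fixes \<alpha> :: real
    and \<sigma> :: "nat \<Rightarrow> nat"
    and \<tau>\<^sub>0 T\<^sub>0 :: nat
    and B :: "nat \<Rightarrow> 'a \<Rightarrow> nat"
  assumes sigma_pos: "\<And>n. n \<ge> 1 \<Longrightarrow> \<sigma> n > 0"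
    and T0_pos: "0 < T\<^sub>0"
    and T0_less: "T\<^sub>0 < \<tau>\<^sub>0"
    and B_measurable: "\<And>n. n \<ge> 1 \<Longrightarrow> B n \<in> measurable M (count_space UNIV)"
    and B_cond_binomial:
      "\<And>n k. AE \<omega> in M.
         real_cond_exp M (natural_filtration M B n)
           (indicator {\<omega> \<in> space M. B (Suc n) \<omega> = k}) \<omega> =
         pmf (binomial_pmf (\<sigma> (Suc n))
               (feedback \<alpha> (real (first_bin T\<^sub>0 B n \<omega>) / real (total_balls \<tau>\<^sub>0 \<sigma> n)))) k"
begin

text \<open>
  This guarantees that \<^const>\<open>real_cond_exp\<close> in the locale assumption is a genuine conditional
  expectation rather than its default value.
\<close>

lemma sigma_finite_subalgebra_natural_filtration:
  "sigma_finite_subalgebra M (natural_filtration M B n)"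
proof -
  have sub: "(\<Union>i\<in>{1..n}. sets (vimage_algebra (space M) (B i) (count_space UNIV))) \<subseteq> sets M"
    using B_measurable by (auto simp: sets_vimage_algebra2 dest: measurable_sets)
  have Pow: "(\<Union>i\<in>{1..n}. sets (vimage_algebra (space M) (B i) (count_space UNIV))) \<subseteq> Pow (space M)"
    using sub sets.space_closed[of M] by (rule subset_trans)
  have "subalgebra M (natural_filtration M B n)"
    unfolding subalgebra_def natural_filtration_def
    using sets.sigma_sets_subset[OF sub] by (simp only: space_measure_of[OF Pow] sets_measure_of[OF Pow] simp_thms)
  then interpret finite_measure_subalgebra M "natural_filtration M B n"
    by unfold_locales
  show ?thesis by unfold_locales
qed

end

definition monopoly :: "'a measure \<Rightarrow> (nat \<Rightarrow> nat) \<Rightarrow> (nat \<Rightarrow> 'a \<Rightarrow> nat) \<Rightarrow> 'a set" where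
  "monopoly M \<sigma> B =
     {\<omega> \<in> space M. \<forall>\<^sub>F n in sequentially. B n \<omega> = 0} \<union>
     {\<omega> \<in> space M. \<forall>\<^sub>F n in sequentially. B n \<omega> = \<sigma> n}"

end

theory Submission imports Defs begin

text \<open>
  Since \<open>feedback \<alpha> x \<ge> x powr \<alpha>\<close> and each bin always holds at least one ball, a bin receives
  no ball at step \<open>n + 1\<close> with conditional probability at most
  \<open>exp (- \<sigma> (n + 1) / \<tau> n powr \<alpha>)\<close>. The limit hypothesis gives \<open>\<sigma> (n + 1) \<ge> \<tau> (n + 1) / 2\<close>
  eventually, so divergence of the series rules out monopoly. If the series converges, the product
  of the probabilities that the first bin never receives a ball is positive. Coexistence has
  positive probability in either case: once the proportions are balanced at a late time, the odds
  are essentially raised to the power \<open>\<alpha>\<close> at each step, so the smaller bin keeps at least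
  \<open>exp (c * \<alpha>^n)\<close> balls for some \<open>c > 0\<close>, and the probabilities that it fails to do so are
  summable.
\<close>

section \<open>Elementary bounds for the feedback function\<close>

lemma feedback_nonneg: "0 \<le> feedback \<alpha> x"
  by (simp add: feedback_def)

lemma feedback_le_one: "feedback \<alpha> x \<le> 1"
  by (cases "x powr \<alpha> + (1 - x) powr \<alpha> = 0")
    (auto simp: feedback_def divide_le_eq_1 less_le add_nonneg_nonneg)

lemma feedback_denominator_pos:
  fixes x \<alpha> :: real
  assumes "0 \<le> x" "x \<le> 1"
  shows "0 < x powr \<alpha> + (1 - x) powr \<alpha>"
proof (cases "x = 0")
  case False
  then have "0 < x powr \<alpha>" using assms by simp
  then show ?thesis by (simp add: add_pos_nonneg)
qed simp

lemma feedback_compl: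
  assumes "0 \<le> x" "x \<le> 1"
  shows "1 - feedback \<alpha> x = feedback \<alpha> (1 - x)"
  using feedback_denominator_pos[OF assms, of \<alpha>] by (simp add: feedback_def field_simps)

text \<open>On [0,1] a power with exponent at least 1 lies below the identity, so the denominator of
  the feedback is at most 1.\<close>

lemma feedback_ge_powr:
  assumes "0 \<le> x" "x \<le> 1" "1 \<le> \<alpha>"
  shows "x powr \<alpha> \<le> feedback \<alpha> x"
proof -
  have le: "y powr \<alpha> \<le> y" if "0 \<le> y" "y \<le> 1" for y :: real
    using powr_mono'[of 1 \<alpha> y] that assms by simp
  have "x powr \<alpha> + (1 - x) powr \<alpha> \<le> 1"
    using le[of x] le[of "1 - x"] assms by simp
  moreover note feedback_denominator_pos[OF assms(1,2), of \<alpha>]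
  ultimately show ?thesis
    by (simp add: feedback_def le_divide_eq mult_left_le)
qed

text \<open>One of \<open>x\<close> and \<open>1 - x\<close> is at least 1/2, so the denominator is
  at least \<open>(1/2) powr \<alpha>\<close>.\<close>

lemma feedback_le_powr:
  assumes "0 \<le> x" "x \<le> 1" "0 \<le> \<alpha>"
  shows "feedback \<alpha> x \<le> (2 * x) powr \<alpha>"
proof -
  have "(1/2) powr \<alpha> \<le> x powr \<alpha> + (1 - x) powr \<alpha>"
  proof (cases "x \<ge> 1/2")
    case True
    then have "(1/2) powr \<alpha> \<le> x powr \<alpha>" using assms by (intro powr_mono2) auto
    then show ?thesis by (simp add: add_increasing2)
  next
    case False
    then have "(1/2) powr \<alpha> \<le> (1 - x) powr \<alpha>" using assms by (intro powr_mono2) auto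
    then show ?thesis by (simp add: add_increasing)
  qed
  then have "feedback \<alpha> x \<le> x powr \<alpha> / (1/2) powr \<alpha>"
    unfolding feedback_def by (intro divide_left_mono mult_pos_pos feedback_denominator_pos assms) auto
  also have "\<dots> = (2 * x) powr \<alpha>"
    using assms by (simp add: powr_mult powr_divide)
  finally show ?thesis .
qed

lemma feedback_pos:
  assumes "0 < x" "x \<le> 1"
  shows "0 < feedback \<alpha> x"
  using assms feedback_denominator_pos[of x \<alpha>] by (simp add: feedback_def)

lemma feedback_less_one:
  assumes "0 \<le> x" "x < 1"
  shows "feedback \<alpha> x < 1"
  using assms feedback_compl[of x \<alpha>] feedback_pos[of "1 - x" \<alpha>] by simp

section \<open>Tail bounds for the binomial distribution\<close>

lemma prob_binomial_eq_sum:
  assumes "0 \<le> p" "p \<le> 1"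
  shows "measure_pmf.prob (binomial_pmf n p) A
    = (\<Sum>k\<in>A \<inter> {..n}. real (n choose k) * p ^ k * (1 - p) ^ (n - k))"
proof -
  have "measure_pmf.prob (binomial_pmf n p) A = measure_pmf.prob (binomial_pmf n p) (A \<inter> {..n})"
    using assms by (intro measure_prob_cong_0) auto
  also have "\<dots> = (\<Sum>k\<in>A \<inter> {..n}. real (n choose k) * p ^ k * (1 - p) ^ (n - k))"
    using assms by (subst measure_measure_pmf_finite) auto
  finally show ?thesis .
qed

lemma one_minus_power_le_exp:
  assumes "x \<le> (1 :: real)"
  shows "(1 - x) ^ n \<le> exp (- (real n * x))"
proof -
  have "(1 - x) ^ n \<le> exp (- x) ^ n"
    using assms exp_ge_add_one_self[of "- x"] by (intro power_mono) auto
  then show ?thesis by (simp add: exp_of_nat_mult[symmetric])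
qed

text \<open>Holds because 2 is at most e. The weight \<open>exp g * (1/2) ^ k\<close> dominates the
  indicator of \<open>k < g\<close> in the exponential Markov inequality for the lower tail.\<close>

lemma one_le_exp_times_half_power:
  assumes "real k \<le> g"
  shows "1 \<le> exp g * (1/2) ^ k"
proof -
  have "2 ^ k \<le> exp (1 :: real) ^ k"
    using exp_ge_add_one_self[of "1 :: real"] by (intro power_mono) auto
  also have "\<dots> \<le> exp g"
    using assms by (simp add: exp_of_nat_mult[symmetric])
  finally show ?thesis by (simp add: field_simps)
qed

text \<open>Exponential Markov inequality: the generating function of the binomial law at 1/2 is
  \<open>(1 - p / 2) ^ n\<close>, which is at most \<open>exp (- (real n * (p / 2)))\<close>. The
  condition on \<open>g\<close> makes the remaining exponent \<open>g - real n * p / 2\<close> at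
  most \<open>- g\<close>.\<close>

lemma prob_binomial_lower_tail:
  assumes p: "0 \<le> p" "p \<le> 1" and g: "4 * g \<le> real n * p"
  shows "measure_pmf.prob (binomial_pmf n p) {k. real k < g} \<le> exp (- g)"
proof -
  let ?f = "\<lambda>k. real (n choose k) * p ^ k * (1 - p) ^ (n - k)"
  have "measure_pmf.prob (binomial_pmf n p) {k. real k < g} = (\<Sum>k\<in>{k. real k < g} \<inter> {..n}. ?f k)"
    using p by (rule prob_binomial_eq_sum)
  also have "\<dots> \<le> (\<Sum>k\<in>{k. real k < g} \<inter> {..n}. ?f k * (exp g * (1/2) ^ k))"
  proof (intro sum_mono)
    fix k assume "k \<in> {k. real k < g} \<inter> {..n}"
    then have "?f k * 1 \<le> ?f k * (exp g * (1/2) ^ k)"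
      using p by (intro mult_left_mono one_le_exp_times_half_power) auto
    then show "?f k \<le> ?f k * (exp g * (1/2) ^ k)" by simp
  qed
  also have "\<dots> \<le> (\<Sum>k\<le>n. ?f k * (exp g * (1/2) ^ k))"
    using p by (intro sum_mono2) auto
  also have "\<dots> = exp g * (p / 2 + (1 - p)) ^ n"
    by (subst binomial_ring) (simp add: sum_distrib_left power_divide mult_ac)
  also have "\<dots> = exp g * (1 - p / 2) ^ n"
    by (simp add: field_simps)
  also have "\<dots> \<le> exp g * exp (- (real n * (p / 2)))"
    using p by (intro mult_left_mono one_minus_power_le_exp) auto
  also have "\<dots> = exp (g - real n * p / 2)"
    by (simp add: exp_add[symmetric])
  also have "\<dots> \<le> exp (- g)"
    using g by simp
  finally show ?thesis .
qed

text \<open>Exchanging successes and failures turns this into the lower tail with parameter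
  \<open>1 - p\<close>.\<close>

lemma prob_binomial_upper_tail:
  assumes p: "0 \<le> p" "p \<le> 1" and g: "4 * g \<le> real n * (1 - p)"
  shows "measure_pmf.prob (binomial_pmf n p) {k. real n - real k < g} \<le> exp (- g)"
proof -
  have "measure_pmf.prob (binomial_pmf n p) {k. real n - real k < g}
      = measure_pmf.prob (binomial_pmf n (1 - p)) {k. real k < g}"
    unfolding prob_binomial_eq_sum[OF p] prob_binomial_eq_sum[of "1 - p", simplified, OF p(2,1)]
    by (rule sum.reindex_bij_witness[of _ "\<lambda>k. n - k" "\<lambda>k. n - k"])
      (auto simp: of_nat_diff binomial_symmetric[symmetric])
  also have "\<dots> \<le> exp (- g)"
    using assms by (intro prob_binomial_lower_tail) auto
  finally show ?thesis .
qed

text \<open>A union bound over a tail of the sequence, starting where the total loss drops below \<open>1/2\<close>.\<close>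

lemma (in finite_measure) measure_INT_pos_of_summable:
  assumes sets: "\<And>n. A n \<in> sets M" and dec: "decseq A"
    and pos: "\<And>n. 0 < measure M (A n)"
    and step: "\<And>n. (1 - e n) * measure M (A n) \<le> measure M (A (Suc n))"
    and e: "summable e" "\<And>n. 0 \<le> e n"
  shows "0 < measure M (\<Inter>n. A n)"
proof -
  obtain N where N: "norm (\<Sum>i. e (i + N)) < 1/2"
    using suminf_exist_split[OF half_gt_zero[OF zero_less_one] e(1)] by blast
  have bound: "measure M (A N) * (1 - (\<Sum>i<n. e (i + N))) \<le> measure M (A (n + N))" for n
  proof (induction n)
    case (Suc n)
    have "e (n + N) * measure M (A (n + N)) \<le> e (n + N) * measure M (A N)"
      using dec sets by (intro mult_left_mono finite_measure_mono e(2)) (auto simp: decseq_def)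
    with Suc step[of "n + N"] show ?case by (simp add: algebra_simps)
  qed simp
  have "measure M (A N) / 2 \<le> measure M (A (n + N))" for n
  proof -
    have "(\<Sum>i<n. e (i + N)) \<le> (\<Sum>i. e (i + N))"
      using e by (intro sum_le_suminf) (auto simp: summable_iff_shift)
    then have "(\<Sum>i<n. e (i + N)) \<le> 1/2" using N by simp
    then have "measure M (A N) * (1/2) \<le> measure M (A N) * (1 - (\<Sum>i<n. e (i + N)))"
      by (intro mult_left_mono) auto
    with bound[of n] show ?thesis by simp
  qed
  moreover have "(\<lambda>n. measure M (A (n + N))) \<longlonglongrightarrow> measure M (\<Inter>n. A n)"
    using sets dec by (intro LIMSEQ_ignore_initial_segment finite_Lim_measure_decseq) auto
  ultimately have "measure M (A N) / 2 \<le> measure M (\<Inter>n. A n)"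
    by (intro LIMSEQ_le_const) auto
  with pos[of N] show ?thesis by linarith
qed

section \<open>One-step conditional probabilities\<close>

context balls_and_bins
begin

text \<open>The index set is arbitrary so that initial blocks \<open>{1..n}\<close> and late blocks
  \<open>{N<..N + n}\<close> are both covered.\<close>

definition cylinder :: "nat set \<Rightarrow> (nat \<Rightarrow> nat set) \<Rightarrow> 'a set" where
  "cylinder I S = {\<omega> \<in> space M. \<forall>i\<in>I. B i \<omega> \<in> S i}"

definition fraction :: "nat \<Rightarrow> 'a \<Rightarrow> real" where
  "fraction n \<omega> = real (first_bin T\<^sub>0 B n \<omega>) / real (total_balls \<tau>\<^sub>0 \<sigma> n)"

text \<open>An everywhere defined version of the conditional law of \<open>B (Suc n)\<close> given
  the first \<open>n\<close> draws. Even where \<open>fraction n \<omega>\<close> exceeds 1, the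
  feedback stays in [0,1].\<close>

definition step_law :: "nat \<Rightarrow> 'a \<Rightarrow> nat pmf" where
  "step_law n \<omega> = binomial_pmf (\<sigma> (Suc n)) (feedback \<alpha> (fraction n \<omega>))"

lemma total_balls_Suc: "total_balls \<tau>\<^sub>0 \<sigma> (Suc n) = total_balls \<tau>\<^sub>0 \<sigma> n + \<sigma> (Suc n)"
  by (simp add: total_balls_def)

lemma total_balls_pos: "0 < total_balls \<tau>\<^sub>0 \<sigma> n"
  using T0_less by (simp add: total_balls_def)

lemma subalgebra_natural_filtration: "subalgebra M (natural_filtration M B n)"
  using sigma_finite_subalgebra_natural_filtration sigma_finite_subalgebra.subalg by blast

lemma space_natural_filtration: "space (natural_filtration M B n) = space M"
  using subalgebra_natural_filtration by (simp add: subalgebra_def)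

lemma vimage_in_natural_filtration:
  assumes "i \<in> {1..n}"
  shows "{\<omega> \<in> space M. B i \<omega> \<in> X} \<in> sets (natural_filtration M B n)"
proof -
  have "(\<Union>i\<in>{1..n}. sets (vimage_algebra (space M) (B i) (count_space UNIV))) \<subseteq> Pow (space M)"
    by (auto simp: sets_vimage_algebra2)
  moreover have "{\<omega> \<in> space M. B i \<omega> \<in> X}
      \<in> (\<Union>i\<in>{1..n}. sets (vimage_algebra (space M) (B i) (count_space UNIV)))"
    using assms by (auto simp: sets_vimage_algebra2 intro!: bexI[of _ i] exI[of _ X])
  ultimately show ?thesis
    by (simp add: natural_filtration_def sets_measure_of sigma_sets.Basic)
qed

lemma cylinder_in_natural_filtration:
  assumes "I \<subseteq> {1..n}"
  shows "cylinder I S \<in> sets (natural_filtration M B n)"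
proof -
  have "{\<omega> \<in> space (natural_filtration M B n). \<forall>i\<in>I. B i \<omega> \<in> S i} \<in> sets (natural_filtration M B n)"
    using assms finite_subset[OF assms] vimage_in_natural_filtration
    by (intro sets.sets_Collect_finite_All) (auto simp: space_natural_filtration)
  then show ?thesis by (simp add: cylinder_def space_natural_filtration)
qed

lemma natural_filtration_sets:
  assumes "A \<in> sets (natural_filtration M B n)"
  shows "A \<in> sets M"
  using assms subalgebra_natural_filtration by (auto simp: subalgebra_def)

lemma cylinder_sets:
  assumes "I \<subseteq> {1..n}"
  shows "cylinder I S \<in> sets M"
  using cylinder_in_natural_filtration[OF assms] by (rule natural_filtration_sets)

lemma B_vimage_sets:
  assumes "n \<ge> 1"
  shows "{\<omega> \<in> space M. B n \<omega> \<in> X} \<in> sets M"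
  using vimage_in_natural_filtration[of n n X] assms by (auto intro: natural_filtration_sets)

lemma first_bin_measurable: "first_bin T\<^sub>0 B n \<in> measurable M (count_space UNIV)"
proof -
  \<comment> \<open>Arbitrary index sets inside \<open>{1..n}\<close> permit induction on finite
    sets while keeping out index 0, where measurability of \<open>B\<close> is not assumed.\<close>
  have "(\<lambda>\<omega>. \<Sum>i\<in>I. B i \<omega>) \<in> measurable M (count_space UNIV)" if "I \<subseteq> {1..n}" for I
    using finite_subset[OF that finite_atLeastAtMost] that
  proof (induction I)
    case (insert i I)
    then have [measurable]: "B i \<in> measurable M (count_space UNIV)"
      "(\<lambda>\<omega>. \<Sum>i\<in>I. B i \<omega>) \<in> measurable M (count_space UNIV)"
      using B_measurable by auto
    have "(\<lambda>\<omega>. B i \<omega> + (\<Sum>i\<in>I. B i \<omega>)) \<in> measurable M (count_space UNIV)"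
      by measurable
    with insert.hyps show ?case by simp
  qed simp
  from this[OF order_refl] have [measurable]:
    "(\<lambda>\<omega>. \<Sum>i=1..n. B i \<omega>) \<in> measurable M (count_space UNIV)" .
  show ?thesis unfolding first_bin_def[abs_def] by measurable
qed

text \<open>The probability depends on \<omega> only through the natural number
  \<open>first_bin\<close>, and every function on a discrete space is measurable.\<close>

lemma step_law_measurable: "(\<lambda>\<omega>. measure_pmf.prob (step_law n \<omega>) S) \<in> borel_measurable M"
proof -
  have "(\<lambda>t. measure_pmf.prob (binomial_pmf (\<sigma> (Suc n))
      (feedback \<alpha> (real t / real (total_balls \<tau>\<^sub>0 \<sigma> n)))) S)
      \<in> measurable (count_space UNIV) borel" by simp
  from measurable_compose[OF first_bin_measurable this]
  show ?thesis by (simp add: step_law_def fraction_def)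
qed

lemma step_law_integrable:
  assumes "A \<in> sets M"
  shows "integrable M (\<lambda>\<omega>. indicator A \<omega> * measure_pmf.prob (step_law n \<omega>) S)"
  using assms step_law_measurable
  by (intro integrable_const_bound[where B = 1])
    (auto simp: indicator_def intro!: borel_measurable_times borel_measurable_indicator)

text \<open>The defining property of conditional expectation on \<open>A\<close>, used for each
  single value \<open>k\<close> and summed over \<open>S\<close>. It puts the binomial assumption of
  the model into the form on which all later estimates rest.\<close>

lemma prob_Int_step:
  assumes A: "A \<in> sets (natural_filtration M B n)" and S: "finite S"
  shows "prob (A \<inter> {\<omega> \<in> space M. B (Suc n) \<omega> \<in> S})
    = (\<integral>\<omega>. indicator A \<omega> * measure_pmf.prob (step_law n \<omega>) S \<partial>M)"
proof -
  interpret sigma_finite_subalgebra M "natural_filtration M B n"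
    by (rule sigma_finite_subalgebra_natural_filtration)
  have AM: "A \<in> sets M" using A by (rule natural_filtration_sets)
  have eq: "prob (A \<inter> {\<omega> \<in> space M. B (Suc n) \<omega> = k})
    = (\<integral>\<omega>. indicator A \<omega> * pmf (step_law n \<omega>) k \<partial>M)" for k
  proof -
    let ?E = "{\<omega> \<in> space M. B (Suc n) \<omega> = k}"
    have E: "?E \<in> sets M" using B_vimage_sets[of "Suc n" "{k}"] by simp
    have "prob (A \<inter> ?E) = (\<integral>\<omega>\<in>A. indicator ?E \<omega> \<partial>M)"
      using AM E by (simp add: set_lebesgue_integral_def indicator_inter_arith[symmetric])
    also have "\<dots> = (\<integral>\<omega>\<in>A. real_cond_exp M (natural_filtration M B n) (indicator ?E) \<omega> \<partial>M)"
      using A E by (intro real_cond_exp_intA integrable_real_indicator) (auto simp: emeasure_eq_measure)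
    also have "\<dots> = (\<integral>\<omega>. indicator A \<omega> * pmf (step_law n \<omega>) k \<partial>M)"
      unfolding set_lebesgue_integral_def
    proof (intro integral_cong_AE)
      show "AE \<omega> in M. indicator A \<omega> *\<^sub>R real_cond_exp M (natural_filtration M B n) (indicator ?E) \<omega>
          = indicator A \<omega> * pmf (step_law n \<omega>) k"
        using B_cond_binomial[of n k] by (auto simp: step_law_def fraction_def)
      show "(\<lambda>\<omega>. indicator A \<omega> * pmf (step_law n \<omega>) k) \<in> borel_measurable M"
        using step_law_integrable[OF AM, of n "{k}"] by (simp add: measure_pmf_single)
    qed (use AM in simp)
    finally show ?thesis .
  qed
  have "prob (A \<inter> {\<omega> \<in> space M. B (Suc n) \<omega> \<in> S})
      = prob (\<Union>k\<in>S. A \<inter> {\<omega> \<in> space M. B (Suc n) \<omega> = k})"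
    by (rule arg_cong[where f = prob]) auto
  also have "\<dots> = (\<Sum>k\<in>S. prob (A \<inter> {\<omega> \<in> space M. B (Suc n) \<omega> = k}))"
    using S AM B_vimage_sets[of "Suc n" "{k}" for k]
    by (intro finite_measure_finite_Union) (auto simp: disjoint_family_on_def)
  also have "\<dots> = (\<Sum>k\<in>S. \<integral>\<omega>. indicator A \<omega> * pmf (step_law n \<omega>) k \<partial>M)"
    by (simp add: eq)
  also have "\<dots> = (\<integral>\<omega>. (\<Sum>k\<in>S. indicator A \<omega> * pmf (step_law n \<omega>) k) \<partial>M)"
    using step_law_integrable[OF AM, of n "{k}" for k]
    by (intro Bochner_Integration.integral_sum[symmetric]) (simp add: measure_pmf_single)
  also have "\<dots> = (\<integral>\<omega>. indicator A \<omega> * measure_pmf.prob (step_law n \<omega>) S \<partial>M)"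
    using S by (simp add: measure_measure_pmf_finite sum_distrib_left)
  finally show ?thesis .
qed

lemma prob_Int_step_ge:
  assumes A: "A \<in> sets (natural_filtration M B n)" and S: "finite S"
    and q: "\<And>\<omega>. \<omega> \<in> A \<Longrightarrow> q \<le> measure_pmf.prob (step_law n \<omega>) S"
  shows "q * prob A \<le> prob (A \<inter> {\<omega> \<in> space M. B (Suc n) \<omega> \<in> S})"
proof -
  have AM: "A \<in> sets M" using A by (rule natural_filtration_sets)
  have "q * prob A = (\<integral>\<omega>. indicator A \<omega> * q \<partial>M)"
    using AM sets.sets_into_space[OF AM] by (simp add: Int_absorb2)
  also have "\<dots> \<le> (\<integral>\<omega>. indicator A \<omega> * measure_pmf.prob (step_law n \<omega>) S \<partial>M)"
    using AM q integrable_real_mult_indicator[OF AM, of "\<lambda>_. q"]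
    by (intro integral_mono step_law_integrable) (auto simp: indicator_def)
  finally show ?thesis by (simp add: prob_Int_step[OF A S])
qed

text \<open>The bound on the step is asked for only almost everywhere, since the second bin is known
  to be nonempty only almost surely.\<close>

lemma prob_Int_step_le:
  assumes A: "A \<in> sets (natural_filtration M B n)" and S: "finite S"
    and q: "AE \<omega> in M. \<omega> \<in> A \<longrightarrow> measure_pmf.prob (step_law n \<omega>) S \<le> q"
  shows "prob (A \<inter> {\<omega> \<in> space M. B (Suc n) \<omega> \<in> S}) \<le> q * prob A"
proof -
  have AM: "A \<in> sets M" using A by (rule natural_filtration_sets)
  have "(\<integral>\<omega>. indicator A \<omega> * measure_pmf.prob (step_law n \<omega>) S \<partial>M) \<le> (\<integral>\<omega>. indicator A \<omega> * q \<partial>M)"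
    using AM q integrable_real_mult_indicator[OF AM, of "\<lambda>_. q"]
    by (intro integral_mono_AE step_law_integrable) (auto simp: indicator_def mult.commute)
  also have "\<dots> = q * prob A"
    using AM sets.sets_into_space[OF AM] by (simp add: Int_absorb2)
  finally show ?thesis by (simp add: prob_Int_step[OF A S])
qed

section \<open>Positive and null cylinder events\<close>

lemma cylinder_insert:
  "cylinder (insert i I) S = cylinder I S \<inter> {\<omega> \<in> space M. B i \<omega> \<in> S i}"
  by (auto simp: cylinder_def)

text \<open>Each further constraint costs at most the proportion \<open>1 - q n\<close> of the
  current event, and these losses are summable. This serves both the event that the first bin never
  receives a ball and the coexistence event.\<close>

lemma prob_cylinder_pos:
  assumes S: "\<And>n. finite (S n)"
    and q: "\<And>n \<omega>. \<omega> \<in> cylinder {1..n} S \<Longrightarrow> q n \<le> measure_pmf.prob (step_law n \<omega>) (S (Suc n))"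
    and q_pos: "\<And>n. 0 < q n" and q_le: "\<And>n. q n \<le> 1" and sum: "summable (\<lambda>n. 1 - q n)"
  shows "0 < prob (\<Inter>n. cylinder {1..n} S)"
proof -
  have step: "q n * prob (cylinder {1..n} S) \<le> prob (cylinder {1..Suc n} S)" for n
  proof -
    have "{1..Suc n} = insert (Suc n) {1..n}" by auto
    then show ?thesis
      using q S by (simp only: cylinder_insert) (intro prob_Int_step_ge cylinder_in_natural_filtration; auto)
  qed
  show ?thesis
  proof (rule measure_INT_pos_of_summable[where e = "\<lambda>n. 1 - q n"])
    show "0 < prob (cylinder {1..n} S)" for n
    proof (induction n)
      case 0
      show ?case by (simp add: cylinder_def prob_space)
    next
      case (Suc n)
      then have "0 < q n * prob (cylinder {1..n} S)" using q_pos by simp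
      with step[of n] show ?case by linarith
    qed
    show "cylinder {1..n} S \<in> sets M" for n by (rule cylinder_sets) auto
  qed (use step q_le sum in \<open>auto simp: decseq_def cylinder_def\<close>)
qed

text \<open>Conditioning step by step from time \<open>N\<close> on multiplies the bounds into the
  exponential of minus a partial sum of a divergent nonnegative series.\<close>

lemma AE_not_cylinder:
  assumes S: "\<And>n. finite (S n)"
    and q: "\<And>n. AE \<omega> in M. measure_pmf.prob (step_law n \<omega>) (S (Suc n)) \<le> exp (- e n)"
    and e: "\<And>n. 0 \<le> e n" "\<not> summable e"
  shows "AE \<omega> in M. \<not> (\<forall>i>N. B i \<omega> \<in> S i)"
proof -
  let ?C = "\<lambda>n. cylinder {N<..N + n} S"
  have C: "?C n \<in> sets M" for n
    by (rule cylinder_sets[of _ "N + n"]) auto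
  have bound: "prob (?C n) \<le> exp (- (\<Sum>i<n. e (i + N)))" for n
  proof (induction n)
    case (Suc n)
    have "{N<..N + Suc n} = insert (Suc (N + n)) {N<..N + n}" by auto
    then have "prob (?C (Suc n)) = prob (?C n \<inter> {\<omega> \<in> space M. B (Suc (N + n)) \<omega> \<in> S (Suc (N + n))})"
      by (simp only: cylinder_insert)
    also have "\<dots> \<le> exp (- e (N + n)) * prob (?C n)"
      using S q[of "N + n"] by (intro prob_Int_step_le cylinder_in_natural_filtration) auto
    also have "\<dots> \<le> exp (- e (N + n)) * exp (- (\<Sum>i<n. e (i + N)))"
      using Suc by (intro mult_left_mono) auto
    also have "\<dots> = exp (- (\<Sum>i<Suc n. e (i + N)))"
      by (simp add: exp_add[symmetric] add_ac)
    finally show ?case .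
  qed simp
  have "prob (\<Inter>n. ?C n) = 0"
  proof (rule ccontr)
    assume "prob (\<Inter>n. ?C n) \<noteq> 0"
    then have pos: "0 < prob (\<Inter>n. ?C n)" by (simp add: zero_less_measure_iff)
    \<comment> \<open>A positive limit probability would bound all partial sums by minus its
      logarithm.\<close>
    have "(\<Sum>i<n. e (i + N)) \<le> - ln (prob (\<Inter>n. ?C n))" for n
    proof -
      have "prob (\<Inter>n. ?C n) \<le> prob (?C n)"
        using C by (intro finite_measure_mono) auto
      then have "prob (\<Inter>n. ?C n) \<le> exp (- (\<Sum>i<n. e (i + N)))"
        using bound[of n] by simp
      with pos show ?thesis by (metis ln_exp ln_le_cancel_iff exp_gt_zero le_minus_iff)
    qed
    then have "summable (\<lambda>i. e (i + N))"
      using e by (intro summableI_nonneg_bounded) auto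
    with e(2) show False by (simp add: summable_iff_shift)
  qed
  moreover have "(\<Inter>n. ?C n) \<in> sets M" using C by auto
  ultimately have "AE \<omega> in M. \<omega> \<notin> (\<Inter>n. ?C n)" by (simp add: prob_eq_0)
  then show ?thesis using AE_space
    by eventually_elim (auto simp: cylinder_def)
qed

section \<open>Almost sure range of the draws and of the fractions\<close>

lemma step_law_gt_eq_0:
  assumes "\<sigma> (Suc n) < k"
  shows "measure_pmf.prob (step_law n \<omega>) {k} = 0"
  using assms by (simp add: step_law_def measure_pmf_single feedback_nonneg feedback_le_one)

text \<open>The range of \<open>B\<close> is not assumed but follows from its law: each of the
  countably many forbidden values has probability 0.\<close>

lemma AE_B_le: "AE \<omega> in M. \<forall>i\<ge>1. B i \<omega> \<le> \<sigma> i"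
proof -
  have "AE \<omega> in M. B (Suc n) \<omega> \<noteq> k" if k: "\<sigma> (Suc n) < k" for n k
  proof -
    \<comment> \<open>The cylinder over no index is the whole space, so the conditional formula
      yields an unconditional probability.\<close>
    have "prob (cylinder {} (\<lambda>_. {}) \<inter> {\<omega> \<in> space M. B (Suc n) \<omega> \<in> {k}}) = 0"
      by (subst prob_Int_step[OF cylinder_in_natural_filtration]) (auto simp: step_law_gt_eq_0 k)
    then have "prob {\<omega> \<in> space M. B (Suc n) \<omega> = k} = 0"
      by (simp add: cylinder_def Int_def)
    then show ?thesis using B_vimage_sets[of "Suc n" "{k}"] AE_space
      by (auto simp: prob_eq_0 elim: AE_mp)
  qed
  then have "AE \<omega> in M. \<forall>n k. \<sigma> (Suc n) < k \<longrightarrow> B (Suc n) \<omega> \<noteq> k"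
    by (simp add: AE_all_countable)
  then show ?thesis
  proof eventually_elim
    case (elim \<omega>)
    show ?case
    proof (intro allI impI)
      fix i :: nat assume "1 \<le> i"
      then obtain n where "i = Suc n" by (cases i) auto
      with elim show "B i \<omega> \<le> \<sigma> i" by (metis not_le)
    qed
  qed
qed

text \<open>Strict because the second bin starts with at least one ball and never loses any.\<close>

lemma first_bin_less_total:
  assumes "\<forall>i\<in>{1..n}. B i \<omega> \<le> \<sigma> i"
  shows "first_bin T\<^sub>0 B n \<omega> < total_balls \<tau>\<^sub>0 \<sigma> n"
  unfolding first_bin_def total_balls_def
  using assms T0_less by (intro add_less_le_mono sum_mono) auto

lemma fraction_ge: "1 / real (total_balls \<tau>\<^sub>0 \<sigma> n) \<le> fraction n \<omega>"
proof -
  have "1 \<le> first_bin T\<^sub>0 B n \<omega>" using T0_pos by (simp add: first_bin_def)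
  then show ?thesis unfolding fraction_def by (intro divide_right_mono) auto
qed

lemma fraction_le:
  assumes "\<forall>i\<in>{1..n}. B i \<omega> \<le> \<sigma> i"
  shows "1 / real (total_balls \<tau>\<^sub>0 \<sigma> n) \<le> 1 - fraction n \<omega>"
  using first_bin_less_total[OF assms] total_balls_pos[of n]
  by (simp add: fraction_def field_simps)

section \<open>No monopoly when the series diverges\<close>

lemma step_law_zero:
  "measure_pmf.prob (step_law n \<omega>) {0} = (1 - feedback \<alpha> (fraction n \<omega>)) ^ \<sigma> (Suc n)"
  by (simp add: step_law_def measure_pmf_single feedback_nonneg feedback_le_one)

lemma step_law_full:
  "measure_pmf.prob (step_law n \<omega>) {\<sigma> (Suc n)} = feedback \<alpha> (fraction n \<omega>) ^ \<sigma> (Suc n)"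
  by (simp add: step_law_def measure_pmf_single feedback_nonneg feedback_le_one)

text \<open>Bounds the probability that a bin with fraction \<open>x\<close> receives nothing. A
  general \<open>x\<close> lets it serve the first bin and, through
  \<open>1 - fraction n \<omega>\<close>, the second.\<close>

lemma power_le_exp_of_reciprocal_le:
  assumes "1 / real (total_balls \<tau>\<^sub>0 \<sigma> n) \<le> x" "x \<le> 1" "1 \<le> \<alpha>"
  shows "(1 - feedback \<alpha> x) ^ \<sigma> (Suc n)
    \<le> exp (- (real (\<sigma> (Suc n)) / real (total_balls \<tau>\<^sub>0 \<sigma> n) powr \<alpha>))"
proof -
  have x: "0 \<le> x" using assms(1) order_trans zero_le_divide_1_iff of_nat_0_le_iff by metis
  have "(1 / real (total_balls \<tau>\<^sub>0 \<sigma> n)) powr \<alpha> \<le> x powr \<alpha>"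
    using assms by (intro powr_mono2) auto
  also have "\<dots> \<le> feedback \<alpha> x" using x assms by (intro feedback_ge_powr)
  finally have "real (\<sigma> (Suc n)) / real (total_balls \<tau>\<^sub>0 \<sigma> n) powr \<alpha> \<le> real (\<sigma> (Suc n)) * feedback \<alpha> x"
    using mult_left_mono[of _ _ "real (\<sigma> (Suc n))"] by (fastforce simp: powr_divide)
  moreover have "(1 - feedback \<alpha> x) ^ \<sigma> (Suc n) \<le> exp (- (real (\<sigma> (Suc n)) * feedback \<alpha> x))"
    using feedback_le_one by (rule one_minus_power_le_exp)
  ultimately show ?thesis by (meson exp_le_cancel_iff neg_le_iff_le order_trans)
qed

lemma monopoly_sets: "monopoly M \<sigma> B \<in> sets M"
proof -
  have "{\<omega> \<in> space M. \<forall>\<^sub>F n in sequentially. B n \<omega> = s n} \<in> sets M" for s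
  proof -
    \<comment> \<open>The index is shifted by one because measurability is only given for
      \<open>B n\<close> with \<open>n \<ge> 1\<close>.\<close>
    have "{\<omega> \<in> space M. \<forall>\<^sub>F n in sequentially. B (Suc n) \<omega> = s (Suc n)} \<in> sets M"
      using B_vimage_sets[of "Suc n" "{s (Suc n)}" for n] unfolding eventually_sequentially
      by (intro sets.sets_Collect_countable_Ex sets.sets_Collect_countable_All
          sets.sets_Collect_imp sets.sets_Collect_const) simp
    then show ?thesis
      by (simp only: eventually_sequentially_Suc[of "\<lambda>n. B n \<omega> = s n" for \<omega>])
  qed
  then show ?thesis unfolding monopoly_def by (intro sets.Un)
qed

text \<open>Monopoly is a countable union over \<open>N\<close> of the events that all draws after
  \<open>N\<close> miss the same bin, and each of these is null. The numerator is \<sigma> because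
  the number of trials governs the chance of missing a bin.\<close>

lemma prob_monopoly_eq_0:
  assumes "1 \<le> \<alpha>" "\<not> summable (\<lambda>n. real (\<sigma> (Suc n)) / real (total_balls \<tau>\<^sub>0 \<sigma> n) powr \<alpha>)"
  shows "prob (monopoly M \<sigma> B) = 0"
proof -
  let ?e = "\<lambda>n. real (\<sigma> (Suc n)) / real (total_balls \<tau>\<^sub>0 \<sigma> n) powr \<alpha>"
  have fr: "AE \<omega> in M. \<forall>n. 1 / real (total_balls \<tau>\<^sub>0 \<sigma> n) \<le> 1 - fraction n \<omega>"
    using AE_B_le by eventually_elim (auto intro!: fraction_le)
  have nonneg: "0 \<le> fraction n \<omega>" for n \<omega> by (simp add: fraction_def)
  have le: "x \<le> 1" if "1 / real (total_balls \<tau>\<^sub>0 \<sigma> n) \<le> 1 - x" for n x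
    using that order_trans[OF _ that, of 0] by simp
  have "AE \<omega> in M. \<not> (\<forall>i>N. B i \<omega> \<in> {0})" for N
  proof (rule AE_not_cylinder[where e = ?e])
    fix n
    show "AE \<omega> in M. measure_pmf.prob (step_law n \<omega>) {0} \<le> exp (- ?e n)"
      using fr by eventually_elim
        (auto simp: step_law_zero intro!: power_le_exp_of_reciprocal_le fraction_ge assms le)
  qed (use assms in auto)
  moreover have "AE \<omega> in M. \<not> (\<forall>i>N. B i \<omega> \<in> {\<sigma> i})" for N
  proof (rule AE_not_cylinder[where e = ?e])
    fix n
    show "AE \<omega> in M. measure_pmf.prob (step_law n \<omega>) {\<sigma> (Suc n)} \<le> exp (- ?e n)"
      using fr
    proof eventually_elim
      case (elim \<omega>)
      \<comment> \<open>A full draw for the first bin is an empty one for the second, so the bound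
        is applied to the second bin's fraction.\<close>
      then have "(1 - feedback \<alpha> (1 - fraction n \<omega>)) ^ \<sigma> (Suc n) \<le> exp (- ?e n)"
        using nonneg assms by (intro power_le_exp_of_reciprocal_le) auto
      moreover have "1 - feedback \<alpha> (1 - fraction n \<omega>) = feedback \<alpha> (fraction n \<omega>)"
        using nonneg[of n \<omega>] le elim by (subst feedback_compl) auto
      ultimately show ?case by (simp add: step_law_full)
    qed
  qed (use assms in auto)
  ultimately have "AE \<omega> in M. (\<forall>N. \<not> (\<forall>i>N. B i \<omega> \<in> {0})) \<and> (\<forall>N. \<not> (\<forall>i>N. B i \<omega> \<in> {\<sigma> i}))"
    by (simp add: AE_all_countable)
  then have "AE \<omega> in M. \<omega> \<notin> monopoly M \<sigma> B"
    by eventually_elim (auto simp: monopoly_def eventually_at_top_dense)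
  then show ?thesis by (simp add: prob_eq_0 monopoly_sets)
qed

section \<open>Monopoly with positive probability when the series converges\<close>

lemma first_bin_const:
  assumes "\<And>i. i \<in> {1..n} \<Longrightarrow> B i \<omega> = 0"
  shows "first_bin T\<^sub>0 B n \<omega> = T\<^sub>0"
  using assms by (simp add: first_bin_def)

lemma total_balls_ge: "\<tau>\<^sub>0 \<le> total_balls \<tau>\<^sub>0 \<sigma> n"
  by (simp add: total_balls_def)

lemma initial_fraction:
  "0 < real T\<^sub>0 / real (total_balls \<tau>\<^sub>0 \<sigma> n)" "real T\<^sub>0 / real (total_balls \<tau>\<^sub>0 \<sigma> n) < 1"
  using T0_pos T0_less total_balls_ge[of n] by (auto simp: divide_less_eq)

text \<open>As long as the first bin receives nothing, its fraction is the deterministic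
  \<open>x n\<close>. The conditional probability that the next draw ends this phase is at most a
  constant times the corresponding term of the series.\<close>

lemma prob_monopoly_pos:
  assumes "0 \<le> \<alpha>" "summable (\<lambda>n. real (total_balls \<tau>\<^sub>0 \<sigma> (Suc n)) / real (total_balls \<tau>\<^sub>0 \<sigma> n) powr \<alpha>)"
  shows "0 < prob (monopoly M \<sigma> B)"
proof -
  define x where "x n = real T\<^sub>0 / real (total_balls \<tau>\<^sub>0 \<sigma> n)" for n
  define q where "q n = (1 - feedback \<alpha> (x n)) ^ \<sigma> (Suc n)" for n
  have x: "0 < x n" "x n < 1" for n
    unfolding x_def by (rule initial_fraction)+
  have q01: "0 < q n" "q n \<le> 1" for n
    unfolding q_def using feedback_less_one[of "x n" \<alpha>] x[of n] feedback_nonneg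
    by (auto intro!: power_le_one)
  have q: "1 - q n \<le> (2 * real T\<^sub>0) powr \<alpha> *
      (real (total_balls \<tau>\<^sub>0 \<sigma> (Suc n)) / real (total_balls \<tau>\<^sub>0 \<sigma> n) powr \<alpha>)" for n
  proof -
    \<comment> \<open>Bernoulli's inequality acts as a union bound over the trials.\<close>
    have "1 - real (\<sigma> (Suc n)) * feedback \<alpha> (x n) \<le> q n"
      using Bernoulli_inequality[of "- feedback \<alpha> (x n)" "\<sigma> (Suc n)"] feedback_le_one[of \<alpha> "x n"]
      by (simp add: q_def)
    then have "1 - q n \<le> real (\<sigma> (Suc n)) * feedback \<alpha> (x n)" by simp
    also have "\<dots> \<le> real (total_balls \<tau>\<^sub>0 \<sigma> (Suc n)) * (2 * x n) powr \<alpha>"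
      using x[of n] assms(1)
      by (intro mult_mono feedback_le_powr) (auto simp: total_balls_Suc feedback_nonneg)
    also have "\<dots> = (2 * real T\<^sub>0) powr \<alpha> *
      (real (total_balls \<tau>\<^sub>0 \<sigma> (Suc n)) / real (total_balls \<tau>\<^sub>0 \<sigma> n) powr \<alpha>)"
      using powr_divide[of "2 * real T\<^sub>0" "real (total_balls \<tau>\<^sub>0 \<sigma> n)" \<alpha>] by (simp add: x_def)
    finally show ?thesis .
  qed
  have "0 < prob (\<Inter>n. cylinder {1..n} (\<lambda>_. {0}))"
  proof (rule prob_cylinder_pos[where q = q])
    show "q n \<le> measure_pmf.prob (step_law n \<omega>) {0}" if "\<omega> \<in> cylinder {1..n} (\<lambda>_. {0})" for n \<omega>
      using that first_bin_const[of n \<omega>]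
      by (simp add: step_law_zero q_def x_def fraction_def cylinder_def)
    show "summable (\<lambda>n. 1 - q n)"
      using q q01 by (intro summable_comparison_test'[OF summable_mult[OF assms(2)]]) auto
  qed (use q01 in auto)
  also have "\<dots> \<le> prob (monopoly M \<sigma> B)"
  proof (intro finite_measure_mono monopoly_sets subsetI)
    fix \<omega> assume \<omega>: "\<omega> \<in> (\<Inter>n. cylinder {1..n} (\<lambda>_. {0}))"
    have "B n \<omega> = 0" if "1 \<le> n" for n
      using INT_D[OF \<omega>, of n] that by (simp add: cylinder_def)
    moreover have "\<omega> \<in> space M" using INT_D[OF \<omega>, of 0] by (simp add: cylinder_def)
    ultimately show "\<omega> \<in> monopoly M \<sigma> B"
      by (auto simp: monopoly_def eventually_sequentially)
  qed
  finally show ?thesis .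
qed

end

section \<open>Growth of the total number of balls\<close>

lemma eventually_ln_ge:
  fixes t :: "nat \<Rightarrow> real"
  assumes lim: "(\<lambda>n. ln (t n) / \<alpha> ^ n) \<longlonglongrightarrow> \<theta>" and "1 < \<alpha>" "0 < \<theta>"
  shows "\<forall>\<^sub>F n in sequentially. \<theta> / 2 * \<alpha> ^ n \<le> ln (t n)"
proof -
  have "\<forall>\<^sub>F n in sequentially. \<theta> / 2 < ln (t n) / \<alpha> ^ n"
    using lim assms by (intro order_tendstoD) auto
  then show ?thesis
    by eventually_elim (use assms in \<open>simp add: field_simps\<close>)
qed

lemma power_at_top:
  fixes \<alpha> :: real
  assumes "1 < \<alpha>"
  shows "filterlim (\<lambda>n. \<alpha> ^ n) at_top sequentially"
  using assms filterlim_realpow_sequentially_gt1[of \<alpha>]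
  by (simp add: filterlim_at_infinity_imp_filterlim_at_top)

text \<open>The quotient of \<open>ln (t (Suc n)) - ln (t n)\<close> by \<open>\<alpha> ^ n\<close>
  tends to \<open>\<alpha> * \<theta> - \<theta>\<close>, which is positive. Hence the difference
  itself diverges and eventually exceeds \<open>ln 2\<close>.\<close>

lemma eventually_double_le_Suc:
  fixes t :: "nat \<Rightarrow> real"
  assumes lim: "(\<lambda>n. ln (t n) / \<alpha> ^ n) \<longlonglongrightarrow> \<theta>" and "1 < \<alpha>" "0 < \<theta>" and t: "\<And>n. 0 < t n"
  shows "\<forall>\<^sub>F n in sequentially. 2 * t n \<le> t (Suc n)"
proof -
  have "(\<lambda>n. \<alpha> * (ln (t (Suc n)) / \<alpha> ^ Suc n) - ln (t n) / \<alpha> ^ n) \<longlonglongrightarrow> \<alpha> * \<theta> - \<theta>"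
    using lim by (intro tendsto_diff tendsto_mult_left LIMSEQ_Suc)
  moreover have "0 < \<alpha> * \<theta> - \<theta>" using assms by simp
  moreover have "filterlim (\<lambda>n. \<alpha> ^ n) at_top sequentially"
    using assms(2) by (rule power_at_top)
  ultimately have "filterlim (\<lambda>n. (\<alpha> * (ln (t (Suc n)) / \<alpha> ^ Suc n) - ln (t n) / \<alpha> ^ n) * \<alpha> ^ n)
      at_top sequentially"
    by (rule filterlim_tendsto_pos_mult_at_top)
  then have "\<forall>\<^sub>F n in sequentially.
      ln 2 \<le> (\<alpha> * (ln (t (Suc n)) / \<alpha> ^ Suc n) - ln (t n) / \<alpha> ^ n) * \<alpha> ^ n"
    by (simp add: filterlim_at_top)
  then show ?thesis
  proof eventually_elim
    case (elim n)
    then have "ln (2 * t n) \<le> ln (t (Suc n))"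
      using assms(2) t[of n] mult_le_cancel_right_pos[of "\<alpha> ^ n" "ln (2 * t n)" "ln (t (Suc n))"]
      by (simp add: divide_simps ln_mult left_diff_distrib distrib_right)
    then show ?case using t[of n] t[of "Suc n"] by simp
  qed
qed

section \<open>Coexistence with positive probability\<close>

context balls_and_bins
begin

text \<open>
  If both bins hold at least the fraction \<open>h n = exp (d - c * \<alpha>^n)\<close> of the balls,
  then the expected gain of each bin is at least \<open>\<sigma> (Suc n) * h n powr \<alpha>\<close>, which is
  \<open>8 * \<sigma> (Suc n) * h (Suc n)\<close> by the choice of \<open>d\<close>; the factor 8 absorbs both the fluctuations
  and the difference between \<open>\<sigma> (Suc n)\<close> and the total number of balls. Since \<open>c < \<theta>\<close>, these
  threshold fractions correspond to a rapidly growing number of balls.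
\<close>

lemma prob_monopoly_less_one:
  assumes \<alpha>: "1 < \<alpha>" and \<theta>: "0 < \<theta>"
    and lim: "(\<lambda>n. ln (real (total_balls \<tau>\<^sub>0 \<sigma> n)) / \<alpha> ^ n) \<longlonglongrightarrow> \<theta>"
  shows "prob (monopoly M \<sigma> B) < 1"
proof -
  define t where "t n = real (total_balls \<tau>\<^sub>0 \<sigma> n)" for n
  \<comment> \<open>Eventually \<open>ln (t n)\<close> is at least
    \<open>2 * c * \<alpha> ^ n\<close>, so half of it remains after multiplication by
    \<open>h n\<close>. The constant \<open>d\<close> solves
    \<open>d * \<alpha> = ln 8 + d\<close>.\<close>
  define c d where "c = \<theta> / 4" and "d = ln 8 / (\<alpha> - 1)"
  define h where "h n = exp (d - c * \<alpha> ^ n)" for n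
  define g where "g n = t n * h n" for n
  have t_pos: "0 < t n" for n using total_balls_pos by (simp add: t_def)
  have c: "0 < c" and d: "0 \<le> d" using \<alpha> \<theta> by (simp_all add: c_def d_def)
  have h_Suc: "h n powr \<alpha> = 8 * h (Suc n)" for n
  proof -
    have "ln 8 + d = d * \<alpha>" using \<alpha> by (simp add: d_def field_simps)
    then have "(d - c * \<alpha> ^ n) * \<alpha> = ln 8 + (d - c * \<alpha> ^ Suc n)"
      by (simp add: algebra_simps)
    then show ?thesis by (simp add: h_def exp_powr_real exp_add)
  qed
  have pow_top: "filterlim (\<lambda>n. c * \<alpha> ^ n) at_top sequentially"
    using c \<alpha> by (intro filterlim_tendsto_pos_mult_at_top[OF tendsto_const] power_at_top) 
  have "\<forall>\<^sub>F n in sequentially. 2 * t n \<le> t (Suc n) \<and> \<theta> / 2 * \<alpha> ^ n \<le> ln (t n)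
      \<and> ln 8 + d \<le> c * \<alpha> ^ n"
    using eventually_double_le_Suc[of t] eventually_ln_ge[of t] lim \<alpha> \<theta> t_pos pow_top
    by (intro eventually_conj) (auto simp: t_def filterlim_at_top)
  \<comment> \<open>From \<open>K\<close> on, each draw makes up at least half of the new total,
    \<open>h n\<close> is at most 1/8, and \<open>g n\<close> is at least
    \<open>exp (c * \<alpha> ^ n)\<close>.\<close>
  then obtain K where K: "\<And>n. K \<le> n \<Longrightarrow> 2 * t n \<le> t (Suc n)"
    "\<And>n. K \<le> n \<Longrightarrow> \<theta> / 2 * \<alpha> ^ n \<le> ln (t n)"
    "\<And>n. K \<le> n \<Longrightarrow> ln 8 + d \<le> c * \<alpha> ^ n"
    by (auto simp: eventually_sequentially)
  have \<sigma>_ge: "t (Suc n) \<le> 2 * real (\<sigma> (Suc n))" if "K \<le> n" for n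
    using K(1)[OF that] by (simp add: t_def total_balls_Suc)
  have h_le: "8 * h n \<le> 1" if "K \<le> n" for n
  proof -
    have "h n \<le> exp (- ln 8)" unfolding h_def using K(3)[OF that] by simp
    then show ?thesis by (simp add: exp_minus)
  qed
  have g_ge: "exp (c * \<alpha> ^ n) \<le> g n" if "K \<le> n" for n
  proof -
    have "exp (c * \<alpha> ^ n) \<le> exp (ln (t n) + (d - c * \<alpha> ^ n))"
      using K(2)[OF that] d by (simp add: c_def)
    also have "\<dots> = g n" using t_pos by (simp add: g_def h_def exp_add)
    finally show ?thesis .
  qed
  have g_gt: "c * \<alpha> ^ n < g n" "4 < g n" if "K \<le> n" for n
  proof -
    show "c * \<alpha> ^ n < g n" using g_ge[OF that] exp_ge_add_one_self[of "c * \<alpha> ^ n"] by linarith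
    have "8 = exp (ln 8 :: real)" by simp
    also have "\<dots> \<le> exp (c * \<alpha> ^ n)" using K(3)[OF that] d by (subst exp_le_cancel_iff) linarith
    finally show "4 < g n" using g_ge[OF that] by linarith
  qed

  \<comment> \<open>Up to time \<open>K\<close> the first bin receives nothing, which makes its
    content deterministic. Draw \<open>K + 1\<close> restores the balance, and from then on every
    draw gives at least \<open>g i\<close> balls to each bin.\<close>
  define S where "S i = (if i \<le> K then {0}
    else {k. g i \<le> real k \<and> k \<le> \<sigma> i \<and> g i \<le> real (\<sigma> i) - real k})" for i
  define p0 where "p0 n = feedback \<alpha> (real T\<^sub>0 / real (total_balls \<tau>\<^sub>0 \<sigma> n))" for n
  \<comment> \<open>For \<open>n \<le> K\<close> the exact probability along the deterministic path
    is taken, and only its positivity matters. Later, two binomial tails are subtracted.\<close>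
  define q where "q n = (if n \<le> K then measure_pmf.prob (binomial_pmf (\<sigma> (Suc n)) (p0 n)) (S (Suc n))
    else 1 - 2 * exp (- g (Suc n)))" for n
  have p0: "0 < p0 n" "p0 n < 1" for n
    unfolding p0_def using initial_fraction[of n]
    by (auto intro: feedback_pos feedback_less_one)
  have S_nonempty: "\<exists>k\<in>S i. k \<le> \<sigma> i" if "i \<le> Suc K" for i
  proof (cases "i \<le> K")
    case False
    then have i: "i = Suc K" using that by simp
    \<comment> \<open>An even split is admissible: \<open>g i\<close> is at most a quarter of the
      draw, and \<open>4 < g i\<close> absorbs the rounding.\<close>
    have "g i \<le> real (\<sigma> i div 2)"
    proof -
      have "8 * g i \<le> t i"
        using mult_left_mono[OF h_le[of i], of "t i"] t_pos[of i] by (simp add: i g_def)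
      moreover have "t i \<le> 2 * real (\<sigma> i)" using \<sigma>_ge[of K] by (simp add: i)
      moreover have "real (\<sigma> i) \<le> 2 * real (\<sigma> i div 2) + 1" by linarith
      ultimately show ?thesis using g_gt(2)[of i] by (simp add: i)
    qed
    moreover have "real (\<sigma> i div 2) \<le> real (\<sigma> i) - real (\<sigma> i div 2)" by linarith
    ultimately have "\<sigma> i div 2 \<in> S i" using False by (simp add: S_def)
    then show ?thesis by (intro bexI[of _ "\<sigma> i div 2"]) auto
  qed (simp add: S_def)
  have q_pos: "0 < q n" for n
  proof (cases "n \<le> K")
    case True
    then obtain k where k: "k \<in> S (Suc n)" "k \<le> \<sigma> (Suc n)" using S_nonempty[of "Suc n"] by auto
    have "0 < pmf (binomial_pmf (\<sigma> (Suc n)) (p0 n)) k"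
      using p0[of n] k by (simp add: less_imp_le)
    also have "\<dots> \<le> q n"
      using k True by (simp add: q_def measure_pmf_single[symmetric] measure_pmf.finite_measure_mono)
    finally show ?thesis .
  next
    case False
    have "exp (- g (Suc n)) < inverse 4"
    proof -
      have "4 < exp (g (Suc n))"
        using g_gt(2)[of "Suc n"] False exp_ge_add_one_self[of "g (Suc n)"] by linarith
      then show ?thesis unfolding exp_minus by (intro less_imp_inverse_less) auto
    qed
    then show ?thesis using False by (simp add: q_def)
  qed
  have "0 < prob (\<Inter>n. cylinder {1..n} S)"
  proof (rule prob_cylinder_pos[where q = q])
    show "finite (S n)" for n
      by (auto simp: S_def intro: finite_subset[of _ "{..\<sigma> n}"])
    show "0 < q n" for n by (rule q_pos)
    show "q n \<le> 1" for n by (simp add: q_def)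
    \<comment> \<open>Since \<open>exp (g (Suc n))\<close> exceeds \<open>c * \<alpha> ^ n\<close>,
      a geometric series dominates.\<close>
    show "summable (\<lambda>n. 1 - q n)"
    proof (rule summable_comparison_test_ev)
      show "summable (\<lambda>n. 2 / c * (1 / \<alpha>) ^ n)"
        using \<alpha> by (intro summable_mult summable_geometric) auto
      show "\<forall>\<^sub>F n in sequentially. norm (1 - q n) \<le> 2 / c * (1 / \<alpha>) ^ n"
        using eventually_gt_at_top[of K]
      proof eventually_elim
        case (elim n)
        have "c * \<alpha> ^ n \<le> c * \<alpha> ^ Suc n"
          using c \<alpha> by (intro mult_left_mono power_increasing) auto
        also have "\<dots> \<le> exp (g (Suc n))"
          using g_gt(1)[of "Suc n"] elim exp_ge_add_one_self[of "g (Suc n)"] by linarith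
        finally have "exp (- g (Suc n)) \<le> inverse (c * \<alpha> ^ n)"
          unfolding exp_minus using c \<alpha> by (intro le_imp_inverse_le) auto
        then show ?case using elim by (simp add: q_def field_simps)
      qed
    qed
    fix n \<omega> assume "\<omega> \<in> cylinder {1..n} S"
    then have \<omega>: "B i \<omega> \<in> S i" if "i \<in> {1..n}" for i
      using that by (simp add: cylinder_def)
    show "q n \<le> measure_pmf.prob (step_law n \<omega>) (S (Suc n))"
    proof (cases "n \<le> K")
      case True
      then have "first_bin T\<^sub>0 B n \<omega> = T\<^sub>0"
        using \<omega> by (intro first_bin_const) (auto simp: S_def split: if_splits)
      with True show ?thesis by (simp add: q_def p0_def step_law_def fraction_def)
    next
      case False
      define p where "p = feedback \<alpha> (fraction n \<omega>)"
      \<comment> \<open>The last draw alone already leaves \<open>g n\<close> balls in each bin,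
        that is, the fraction \<open>h n\<close> of the total.\<close>
      have Bn: "g n \<le> real (B n \<omega>)" "g n \<le> real (\<sigma> n) - real (B n \<omega>)"
        using \<omega>[of n] False by (auto simp: S_def)
      have n: "n \<in> {1..n}" using False by auto
      have B_le: "B i \<omega> \<le> \<sigma> i" if "i \<in> {1..n}" for i
        using \<omega>[OF that] by (auto simp: S_def split: if_splits)
      have "real (B n \<omega>) \<le> (\<Sum>i=1..n. real (B i \<omega>))"
        using n by (intro member_le_sum) auto
      then have "g n \<le> real (first_bin T\<^sub>0 B n \<omega>)"
        using Bn(1) by (simp add: first_bin_def)
      then have lo: "h n \<le> fraction n \<omega>"
        using t_pos[of n] by (simp add: fraction_def g_def t_def[symmetric] field_simps)
      have "real (\<sigma> n) - real (B n \<omega>) \<le> (\<Sum>i=1..n. real (\<sigma> i) - real (B i \<omega>))"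
        using n B_le by (intro member_le_sum[where f = "\<lambda>i. real (\<sigma> i) - real (B i \<omega>)"]) auto
      then have "g n \<le> t n - real (first_bin T\<^sub>0 B n \<omega>)"
        using Bn(2) T0_less by (simp add: first_bin_def t_def total_balls_def sum_subtractf)
      then have hi: "h n \<le> 1 - fraction n \<omega>"
        using t_pos[of n] by (simp add: fraction_def g_def t_def[symmetric] field_simps)
      have h_pos: "0 < h n" by (simp add: h_def)
      \<comment> \<open>The factor 8 is spent as 4 for the tail bounds and 2 for replacing
        \<open>\<sigma> (Suc n)\<close> by \<open>t (Suc n)\<close>. A general \<open>x\<close>
        covers both bins.\<close>
      have large: "4 * g (Suc n) \<le> real (\<sigma> (Suc n)) * feedback \<alpha> x" if "h n \<le> x" "x \<le> 1" for x
      proof -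
        have "8 * h (Suc n) \<le> x powr \<alpha>"
          unfolding h_Suc[symmetric] using that h_pos \<alpha> by (intro powr_mono2) auto
        also have "\<dots> \<le> feedback \<alpha> x"
          using that h_pos \<alpha> by (intro feedback_ge_powr) auto
        finally have "real (\<sigma> (Suc n)) * (8 * h (Suc n)) \<le> real (\<sigma> (Suc n)) * feedback \<alpha> x"
          by (intro mult_left_mono) auto
        moreover have "4 * g (Suc n) \<le> real (\<sigma> (Suc n)) * (8 * h (Suc n))"
          using mult_right_mono[OF \<sigma>_ge[of n], of "4 * h (Suc n)"] False
          by (simp add: g_def h_def mult_ac)
        ultimately show ?thesis by linarith
      qed
      have p: "0 \<le> p" "p \<le> 1" by (simp_all add: p_def feedback_nonneg feedback_le_one)
      have "4 * g (Suc n) \<le> real (\<sigma> (Suc n)) * p"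
        unfolding p_def using lo hi h_pos by (intro large) auto
      then have lower: "measure_pmf.prob (step_law n \<omega>) {k. real k < g (Suc n)} \<le> exp (- g (Suc n))"
        unfolding step_law_def p_def[symmetric] using p by (intro prob_binomial_lower_tail)
      have "1 - p = feedback \<alpha> (1 - fraction n \<omega>)"
        unfolding p_def using lo hi h_pos by (intro feedback_compl) auto
      then have "4 * g (Suc n) \<le> real (\<sigma> (Suc n)) * (1 - p)"
        using lo hi h_pos large[of "1 - fraction n \<omega>"] by simp
      then have upper: "measure_pmf.prob (step_law n \<omega>) {k. real (\<sigma> (Suc n)) - real k < g (Suc n)}
          \<le> exp (- g (Suc n))"
        unfolding step_law_def p_def[symmetric] using p by (intro prob_binomial_upper_tail)
      \<comment> \<open>Values beyond \<open>\<sigma> (Suc n)\<close> fall into the second set,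
        since the real difference is negative there and \<open>g (Suc n)\<close> is
        positive.\<close>
      have "- S (Suc n) \<subseteq> {k. real k < g (Suc n)} \<union> {k. real (\<sigma> (Suc n)) - real k < g (Suc n)}"
        using False g_gt(2)[of "Suc n"] by (auto simp: S_def not_le)
      then have "measure_pmf.prob (step_law n \<omega>) (- S (Suc n)) \<le> 2 * exp (- g (Suc n))"
        using lower upper
          measure_pmf.finite_measure_mono[of "- S (Suc n)"
            "{k. real k < g (Suc n)} \<union> {k. real (\<sigma> (Suc n)) - real k < g (Suc n)}" "step_law n \<omega>"]
          measure_Un_le[of "{k. real k < g (Suc n)}" "step_law n \<omega>"
            "{k. real (\<sigma> (Suc n)) - real k < g (Suc n)}"]
        by simp
      then show ?thesis
        using False measure_pmf.prob_compl[of "S (Suc n)" "step_law n \<omega>"]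
        by (simp add: q_def Compl_eq_Diff_UNIV)
    qed
  qed
  \<comment> \<open>As \<open>g n\<close> is positive, both bins receive a ball at every step after
    \<open>K\<close>.\<close>
  moreover have "(\<Inter>n. cylinder {1..n} S) \<subseteq> space M - monopoly M \<sigma> B"
  proof
    fix \<omega> assume \<omega>: "\<omega> \<in> (\<Inter>n. cylinder {1..n} S)"
    have "B n \<omega> \<noteq> 0 \<and> B n \<omega> \<noteq> \<sigma> n" if "K < n" for n
    proof -
      have "B n \<omega> \<in> S n" using INT_D[OF \<omega>, of n] that by (auto simp: cylinder_def)
      then show ?thesis using that g_gt(2)[of n] by (auto simp: S_def)
    qed
    then have "\<forall>\<^sub>F n in sequentially. B n \<omega> \<noteq> 0" "\<forall>\<^sub>F n in sequentially. B n \<omega> \<noteq> \<sigma> n"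
      by (auto simp: eventually_at_top_dense)
    then have "\<not> (\<forall>\<^sub>F n in sequentially. B n \<omega> = 0)" "\<not> (\<forall>\<^sub>F n in sequentially. B n \<omega> = \<sigma> n)"
      by (auto dest: eventually_happens[OF eventually_conj])
    moreover have "\<omega> \<in> space M" using INT_D[OF \<omega>, of 0] by (simp add: cylinder_def)
    ultimately show "\<omega> \<in> space M - monopoly M \<sigma> B" by (simp add: monopoly_def)
  qed
  then have "prob (\<Inter>n. cylinder {1..n} S) \<le> prob (space M - monopoly M \<sigma> B)"
    by (intro finite_measure_mono) (auto intro: monopoly_sets)
  ultimately show ?thesis
    using prob_compl[OF monopoly_sets] by simp
qed

end

theorem theorem1p5:
  fixes M :: "'a measure" and \<alpha> \<theta> :: real and \<sigma> :: "nat \<Rightarrow> nat"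
    and \<tau>\<^sub>0 T\<^sub>0 :: nat and B :: "nat \<Rightarrow> 'a \<Rightarrow> nat"
  assumes "balls_and_bins M \<alpha> \<sigma> \<tau>\<^sub>0 T\<^sub>0 B"
    and "\<alpha> > 1"
    and "(\<lambda>n. ln (real (total_balls \<tau>\<^sub>0 \<sigma> n)) / \<alpha> ^ n) \<longlonglongrightarrow> \<theta>"
    and "\<theta> > 0"
  shows "(\<not> summable (\<lambda>n. real (total_balls \<tau>\<^sub>0 \<sigma> (Suc n)) / real (total_balls \<tau>\<^sub>0 \<sigma> n) powr \<alpha>)
            \<longrightarrow> measure M (monopoly M \<sigma> B) = 0)
       \<and> (summable (\<lambda>n. real (total_balls \<tau>\<^sub>0 \<sigma> (Suc n)) / real (total_balls \<tau>\<^sub>0 \<sigma> n) powr \<alpha>)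
            \<longrightarrow> 0 < measure M (monopoly M \<sigma> B) \<and> measure M (monopoly M \<sigma> B) < 1)"
proof (intro conjI impI)
  interpret balls_and_bins M \<alpha> \<sigma> \<tau>\<^sub>0 T\<^sub>0 B by fact
  let ?t = "\<lambda>n. real (total_balls \<tau>\<^sub>0 \<sigma> n)"
  show "measure M (monopoly M \<sigma> B) = 0" if diverges: "\<not> summable (\<lambda>n. ?t (Suc n) / ?t n powr \<alpha>)"
  proof (rule prob_monopoly_eq_0)
    show "1 \<le> \<alpha>" using assms(2) by simp
    \<comment> \<open>Doubling gives \<open>?t (Suc n) \<le> 2 * real (\<sigma> (Suc n))\<close>
      eventually, which carries the divergence over to the series with \<sigma> in the
      numerator.\<close>
    have "\<forall>\<^sub>F n in sequentially. 2 * ?t n \<le> ?t (Suc n)"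
      using assms(2-4) total_balls_pos by (intro eventually_double_le_Suc) auto
    then have "\<forall>\<^sub>F n in sequentially.
        norm (?t (Suc n) / ?t n powr \<alpha>) \<le> 2 * (real (\<sigma> (Suc n)) / ?t n powr \<alpha>)"
      by eventually_elim (simp add: total_balls_Suc divide_right_mono)
    from summable_comparison_test_ev[OF this]
    show "\<not> summable (\<lambda>n. real (\<sigma> (Suc n)) / ?t n powr \<alpha>)"
      using diverges summable_mult[of "\<lambda>n. real (\<sigma> (Suc n)) / ?t n powr \<alpha>" 2] by auto
  qed
  show "0 < measure M (monopoly M \<sigma> B)" if "summable (\<lambda>n. ?t (Suc n) / ?t n powr \<alpha>)"
    using assms(2) that by (intro prob_monopoly_pos) auto
  show "measure M (monopoly M \<sigma> B) < 1"
    using assms(2-4) by (intro prob_monopoly_less_one)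
qed

end
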